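(* Let $\mathcal{T}'$ be the polynomial-valued invariant of polymatroids given by the following recursion. If $P$ is a polymatroid on the empty ground set, then $\mathcal{T}'_P(x,y)=1$. If $P$ is a polymatroid on a nonempty finite ground set $E$, then for any $t\in E$, $$\mathcal{T}'_P(x,y)=\begin{cases}(x+y-1)\,\mathcal{T}'_{P\setminus t}(x,y), & \text{if } |T_t|=1,\\[2pt] x\,\mathcal{T}'_{P\setminus t}(x,y)+y\,\mathcal{T}'_{P/t}(x,y)+\displaystyle\sum_{j\in T_t\setminus\{\alpha_t,\beta_t\}}\mathcal{T}'_{\widehat{P}^t_j}(x,y), & \text{if } |T_t|\ge 2.\end{cases}$$ Then $\mathcal{T}'_P(x,y)$ is well-defined for every polymatroid $P$, i.e. the polynomial obtained by applying this recursion does not depend on the choice of the element $t$ made at each step. Moreover, $\mathcal{T}'_P(x,y)=\mathcal{T}_P(x,y)$ for every polymatroid $P$.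
   Context: Polymatroids. Let $E$ be a finite set of positive integers, ordered by the usual order of integers (for $E=[n]=\{1,\dots,n\}$ this is $1<2<\dots<n$), and let $\mathbf{e}_i$ ($i\in E$) be the standard basis vectors of $\mathbb{Z}^E$. Let $f:2^E\to\mathbb{Z}$ satisfy $f(\emptyset)=0$ and $f(I)+f(J)\ge f(I\cup J)+f(I\cap J)$ for all $I,J\subseteq E$. The polymatroid with rank function $f$ is $$P=P_f=\Big\{\mathbf{a}=(a_i)_{i\in E}\in\mathbb{Z}^E:\ \sum_{i\in I}a_i\le f(I)\ \text{for all } I\subseteq E,\ \ \sum_{i\in E}a_i=f(E)\Big\};$$ its elements are called bases. Deletion and contraction. For $t\in E$, the deletion $P\setminus t$ and contraction $P/t$ are the polymatroids on $E\setminus\{t\}$ with rank functions $f_{P\setminus t}(I)=f(I)$ and $f_{P/t}(I)=f(I\cup\{t\})-f(\{t\})$ for $I\subseteq E\setminus\{t\}$. Slices. For $t\in E$ let $\alpha_t=f(E)-f(E\setminus\{t\})$, $\beta_t=f(\{t\})$, and $T_t=\{\alpha_t,\alpha_t+1,\dots,\beta_t\}$. For $j\in T_t$, let $P^t_j=\{\mathbf{a}\in P: a_t=j\}$ and let $\widehat{P}^t_j\subseteq\mathbb{Z}^{E\setminus\{t\}}$ be the set of vectors obtained from the elements of $P^t_j$ by deleting the coordinate $a_t$. (It is known that $\widehat{P}^t_j$ is a polymatroid on $E\setminus\{t\}$, with rank function $I\mapsto\min\{f(I),\,f(I\cup\{t\})-j\}$, and that $\widehat{P}^t_{\alpha_t}=P\setminus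 t$, $\widehat{P}^t_{\beta_t}=P/t$.) Polymatroid Tutte polynomial (Bernardi–Kálmán–Postnikov). For a basis $\mathbf{a}\in P$, an index $i\in E$ is internally active if $\mathbf{a}-\mathbf{e}_i+\mathbf{e}_j\notin P$ for every $j\in E$ with $j<i$, and externally active if $\mathbf{a}+\mathbf{e}_i-\mathbf{e}_j\notin P$ for every $j\in E$ with $j<i$. Let $\mathrm{Int}(\mathbf{a})$, $\mathrm{Ext}(\mathbf{a})$ be the sets of internally and externally active indices, and put $oi(\mathbf{a})=|\mathrm{Int}(\mathbf{a})\setminus\mathrm{Ext}(\mathbf{a})|$, $oe(\mathbf{a})=|\mathrm{Ext}(\mathbf{a})\setminus\mathrm{Int}(\mathbf{a})|$, $ie(\mathbf{a})=|\mathrm{Int}(\mathbf{a})\cap\mathrm{Ext}(\mathbf{a})|$. Then $$\mathcal{T}_P(x,y)=\sum_{\mathbf{a}\in P}x^{oi(\mathbf{a})}y^{oe(\mathbf{a})}(x+y-1)^{ie(\mathbf{a})}.$$ (It is known that $\mathcal{T}_P$ depends only on $P$ and not on the ordering of $E$.) *)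

theory Defs
  imports "HOL-Library.FuncSet" "HOL-Computational_Algebra.Polynomial"
begin

text \<open>
  The ground set is a finite set of positive integers, of type \<^typ>\<open>nat set\<close>.  A rank function
  on \<open>E\<close> is a total function on \<^typ>\<open>nat set\<close> of which only the values on subsets of \<open>E\<close>
  are used.
\<close>

definition rank_function :: "nat set \<Rightarrow> (nat set \<Rightarrow> int) \<Rightarrow> bool" where
  "rank_function E f \<longleftrightarrow>
     finite E \<and> (\<forall>i\<in>E. 0 < i) \<and> f {} = 0 \<and>
     (\<forall>I J. I \<subseteq> E \<longrightarrow> J \<subseteq> E \<longrightarrow> f I + f J \<ge> f (I \<union> J) + f (I \<inter> J))"

text \<open>
  \<open>\<int>\<^sup>E\<close> is the extensional function space \<^term>\<open>E \<rightarrow>\<^sub>E (UNIV :: int set)\<close>, so a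
  polymatroid is a set of such functions, and the only vector over the empty ground set
  is \<^term>\<open>(\<lambda>_. undefined) :: nat \<Rightarrow> int\<close>.
\<close>

definition polymatroid :: "nat set \<Rightarrow> (nat set \<Rightarrow> int) \<Rightarrow> (nat \<Rightarrow> int) set" where
  "polymatroid E f =
     {a \<in> E \<rightarrow>\<^sub>E UNIV. (\<forall>I. I \<subseteq> E \<longrightarrow> (\<Sum>i\<in>I. a i) \<le> f I) \<and> (\<Sum>i\<in>E. a i) = f E}"

definition deletion :: "nat set \<Rightarrow> (nat set \<Rightarrow> int) \<Rightarrow> nat \<Rightarrow> (nat \<Rightarrow> int) set" where
  "deletion E f t = polymatroid (E - {t}) f"

definition contraction :: "nat set \<Rightarrow> (nat set \<Rightarrow> int) \<Rightarrow> nat \<Rightarrow> (nat \<Rightarrow> int) set" where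
  "contraction E f t = polymatroid (E - {t}) (\<lambda>I. f (I \<union> {t}) - f {t})"

definition alpha :: "nat set \<Rightarrow> (nat set \<Rightarrow> int) \<Rightarrow> nat \<Rightarrow> int" where
  "alpha E f t = f E - f (E - {t})"

definition beta :: "(nat set \<Rightarrow> int) \<Rightarrow> nat \<Rightarrow> int" where
  "beta f t = f {t}"

definition T_range :: "nat set \<Rightarrow> (nat set \<Rightarrow> int) \<Rightarrow> nat \<Rightarrow> int set" where
  "T_range E f t = {alpha E f t..beta f t}"

definition projected_slice :: "nat set \<Rightarrow> (nat \<Rightarrow> int) set \<Rightarrow> nat \<Rightarrow> int \<Rightarrow> (nat \<Rightarrow> int) set" where
  "projected_slice E P t j = (\<lambda>a. restrict a (E - {t})) ` {a \<in> P. a t = j}"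

text \<open>
  In both notions of activity \<open>j < i\<close>, hence \<open>j \<noteq> i\<close>, so that the function updates are
  \<open>a - e\<^sub>i + e\<^sub>j\<close> and \<open>a + e\<^sub>i - e\<^sub>j\<close>.
\<close>

definition Int_act :: "nat set \<Rightarrow> (nat \<Rightarrow> int) set \<Rightarrow> (nat \<Rightarrow> int) \<Rightarrow> nat set" where
  "Int_act E P a = {i \<in> E. \<forall>j\<in>E. j < i \<longrightarrow> a(i := a i - 1, j := a j + 1) \<notin> P}"

definition Ext_act :: "nat set \<Rightarrow> (nat \<Rightarrow> int) set \<Rightarrow> (nat \<Rightarrow> int) \<Rightarrow> nat set" where
  "Ext_act E P a = {i \<in> E. \<forall>j\<in>E. j < i \<longrightarrow> a(i := a i + 1, j := a j - 1) \<notin> P}"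

definition oi :: "nat set \<Rightarrow> (nat \<Rightarrow> int) set \<Rightarrow> (nat \<Rightarrow> int) \<Rightarrow> nat" where
  "oi E P a = card (Int_act E P a - Ext_act E P a)"

definition oe :: "nat set \<Rightarrow> (nat \<Rightarrow> int) set \<Rightarrow> (nat \<Rightarrow> int) \<Rightarrow> nat" where
  "oe E P a = card (Ext_act E P a - Int_act E P a)"

definition ie :: "nat set \<Rightarrow> (nat \<Rightarrow> int) set \<Rightarrow> (nat \<Rightarrow> int) \<Rightarrow> nat" where
  "ie E P a = card (Int_act E P a \<inter> Ext_act E P a)"

text \<open>\<open>\<int>[x, y]\<close> is represented as \<open>\<int>[x][y]\<close>, the type \<^typ>\<open>int poly poly\<close>.\<close>

definition var_x :: "int poly poly" where
  "var_x = [:[:0, 1:]:]"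

definition var_y :: "int poly poly" where
  "var_y = [:0, 1:]"

definition tutte :: "nat set \<Rightarrow> (nat \<Rightarrow> int) set \<Rightarrow> int poly poly" where
  "tutte E P =
     (\<Sum>a\<in>P. var_x ^ oi E P a * var_y ^ oe E P a * (var_x + var_y - 1) ^ ie E P a)"

text \<open>
  \<open>rec_value E P p\<close> says that \<open>p\<close> is a possible result of running the recursion on the
  polymatroid \<open>P\<close> over \<open>E\<close>.  The element \<open>t\<close> is chosen freely in every rule application, and
  independently for the different minors and slices that occur, even if some of these coincide.
\<close>

inductive rec_value :: "nat set \<Rightarrow> (nat \<Rightarrow> int) set \<Rightarrow> int poly poly \<Rightarrow> bool" where
  empty:
    "rank_function {} f \<Longrightarrow> rec_value {} (polymatroid {} f) 1"
| single:
    "\<lbrakk>rank_function E f; t \<in> E; card (T_range E f t) = 1;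
      rec_value (E - {t}) (deletion E f t) p\<rbrakk>
     \<Longrightarrow> rec_value E (polymatroid E f) ((var_x + var_y - 1) * p)"
| multiple:
    "\<lbrakk>rank_function E f; t \<in> E; card (T_range E f t) \<ge> 2;
      rec_value (E - {t}) (deletion E f t) p;
      rec_value (E - {t}) (contraction E f t) q;
      \<And>j. j \<in> T_range E f t - {alpha E f t, beta f t} \<Longrightarrow>
        rec_value (E - {t}) (projected_slice E (polymatroid E f) t j) (r j)\<rbrakk>
     \<Longrightarrow> rec_value E (polymatroid E f)
           (var_x * p + var_y * q + (\<Sum>j\<in>T_range E f t - {alpha E f t, beta f t}. r j))"

text \<open>The invariant defined by the recursion; meaningful only where the result is unique.\<close>

definition tutte_rec :: "nat set \<Rightarrow> (nat \<Rightarrow> int) set \<Rightarrow> int poly poly" where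
  "tutte_rec E P = (THE p. rec_value E P p)"

end

theory Submission
  imports Defs
begin

text \<open>
  It suffices to show that \<^const>\<open>tutte\<close> satisfies the recursion at every \<open>t \<in> E\<close>.  For
  \<open>t = Max E\<close> this is direct: the activity of smaller elements at a basis \<open>a\<close> can be read off the
  slice containing \<open>a\<close>, while a union or intersection of tight sets shows that \<open>t\<close> is internally
  active iff \<open>a t\<close> is minimal and externally active iff \<open>a t\<close> is maximal.  For other \<open>t\<close>, by
  induction, expand at \<open>Max E\<close> and then at \<open>t\<close>.  The pairs of values of the two coordinates fill a
  hexagon, and the weights obtained in the two orders of expansion differ only at vertices of its
  two diagonal edges.  The double slice is constant along each of these edges, so the differences
  cancel.  This replaces the independence of \<^const>\<open>tutte\<close> from the order on \<open>E\<close>.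
\<close>

section \<open>Polymatroids and their slices\<close>

lemma rank_function_finite: "rank_function E f \<Longrightarrow> finite E"
  by (simp add: rank_function_def)

lemma rank_function_empty: "rank_function E f \<Longrightarrow> f {} = 0"
  by (simp add: rank_function_def)

lemma rank_function_submodular:
  "rank_function E f \<Longrightarrow> I \<subseteq> E \<Longrightarrow> J \<subseteq> E \<Longrightarrow> f (I \<union> J) + f (I \<inter> J) \<le> f I + f J"
  by (simp add: rank_function_def)

lemma rank_function_submodular_eq:
  assumes "rank_function E f" "I \<subseteq> E" "J \<subseteq> E" "I \<union> J = K" "I \<inter> J = L"
  shows "f K + f L \<le> f I + f J"
  using rank_function_submodular[OF assms(1-3)] assms(4,5) by simp

lemma alpha_le_beta:
  assumes "rank_function E f" "t \<in> E"
  shows "alpha E f t \<le> beta f t"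
proof -
  have "f E + f {} \<le> f (E - {t}) + f {t}"
    by (rule rank_function_submodular_eq[OF assms(1)]) (use assms(2) in auto)
  then show ?thesis
    using rank_function_empty[OF assms(1)] by (simp add: alpha_def beta_def)
qed

lemma polymatroid_cong:
  "(\<And>I. I \<subseteq> E \<Longrightarrow> f I = g I) \<Longrightarrow> polymatroid E f = polymatroid E g"
  by (auto simp: polymatroid_def)

lemma polymatroid_PiE: "a \<in> polymatroid E f \<Longrightarrow> a \<in> E \<rightarrow>\<^sub>E UNIV"
  by (simp add: polymatroid_def)

lemma polymatroid_sum_le: "a \<in> polymatroid E f \<Longrightarrow> I \<subseteq> E \<Longrightarrow> sum a I \<le> f I"
  by (simp add: polymatroid_def)

lemma polymatroid_coord_bounds:
  assumes "rank_function E f" "a \<in> polymatroid E f" "t \<in> E"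
  shows "alpha E f t \<le> a t" "a t \<le> beta f t"
proof -
  have "sum a E = a t + sum a (E - {t})"
    using rank_function_finite[OF assms(1)] assms(3) by (rule sum.remove)
  moreover have "sum a E = f E" using assms(2) by (simp add: polymatroid_def)
  moreover have "sum a (E - {t}) \<le> f (E - {t})"
    using assms(2) by (rule polymatroid_sum_le) auto
  ultimately show "alpha E f t \<le> a t" by (simp add: alpha_def)
  have "sum a {t} \<le> f {t}"
    using assms(2) by (rule polymatroid_sum_le) (use assms(3) in auto)
  then show "a t \<le> beta f t" by (simp add: beta_def)
qed

lemma finite_polymatroid:
  assumes "rank_function E f"
  shows "finite (polymatroid E f)"
proof (rule finite_subset)
  show "polymatroid E f \<subseteq> (\<Pi>\<^sub>E i\<in>E. {alpha E f i..beta f i})"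
  proof
    fix a assume a: "a \<in> polymatroid E f"
    show "a \<in> (\<Pi>\<^sub>E i\<in>E. {alpha E f i..beta f i})"
      using polymatroid_coord_bounds[OF assms a] polymatroid_PiE[OF a] by (simp add: PiE_iff)
  qed
  show "finite (\<Pi>\<^sub>E i\<in>E. {alpha E f i..beta f i})"
    using rank_function_finite[OF assms] by (intro finite_PiE) auto
qed

section \<open>Projected slices as polymatroids, with deletion and contraction as the extreme
  slices\<close>

definition slice_rank :: "(nat set \<Rightarrow> int) \<Rightarrow> nat \<Rightarrow> int \<Rightarrow> nat set \<Rightarrow> int" where
  "slice_rank f t j I = min (f I) (f (insert t I) - j)"

text \<open>At \<open>I\<close> both sides are the minimum of the same four terms
  \<open>f I\<close>, \<open>f (insert s I) - j\<close>, \<open>f (insert t I) - k\<close> and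
  \<open>f (insert s (insert t I)) - j - k\<close>.\<close>

lemma slice_rank_commute: "slice_rank (slice_rank f s j) t k = slice_rank (slice_rank f t k) s j"
  by (simp add: fun_eq_iff slice_rank_def min_def insert_commute)

lemma rank_function_slice_rank:
  assumes f: "rank_function E f" and t: "t \<in> E" and j: "j \<in> T_range E f t"
  shows "rank_function (E - {t}) (slice_rank f t j)"
  unfolding rank_function_def
proof (intro conjI allI impI)
  show "finite (E - {t})" "\<forall>i\<in>E - {t}. 0 < i"
    using f by (auto simp: rank_function_def)
  show "slice_rank f t j {} = 0"
    using rank_function_empty[OF f] j by (simp add: slice_rank_def T_range_def beta_def)
next
  fix I J assume I: "I \<subseteq> E - {t}" and J: "J \<subseteq> E - {t}"
  note sub = rank_function_submodular_eq[OF f]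
  \<comment> \<open>One inequality for each way the two minima on the right can be attained. In the
    mixed cases \<open>t\<close> goes to the union alone, so \<open>j\<close> is subtracted once on
    each side.\<close>
  have "f (I \<union> J) + f (I \<inter> J) \<le> f I + f J"
    by (rule sub) (use I J in auto)
  moreover have "f (insert t (I \<union> J)) + f (I \<inter> J) \<le> f I + f (insert t J)"
    by (rule sub) (use I J t in auto)
  moreover have "f (insert t (I \<union> J)) + f (I \<inter> J) \<le> f (insert t I) + f J"
    by (rule sub) (use I J t in auto)
  moreover have "f (insert t (I \<union> J)) + f (insert t (I \<inter> J)) \<le> f (insert t I) + f (insert t J)"
    by (rule sub) (use I J t in auto)
  ultimately show "slice_rank f t j (I \<union> J) + slice_rank f t j (I \<inter> J)
      \<le> slice_rank f t j I + slice_rank f t j J"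
    unfolding slice_rank_def by linarith
qed

text \<open>The constraints on \<open>b\<close> come in pairs, for \<open>I\<close> and
  \<open>insert t I\<close> with \<open>I\<close> avoiding \<open>t\<close>. Moving
  \<open>b t\<close> to the right-hand side turns each pair into one bound by the minimum in
  \<open>slice_rank\<close>.\<close>

lemma restrict_mem_slice_iff:
  assumes f: "rank_function E f" and t: "t \<in> E"
    and b: "b \<in> E \<rightarrow>\<^sub>E UNIV" and bt: "b t \<in> T_range E f t"
  shows "restrict b (E - {t}) \<in> polymatroid (E - {t}) (slice_rank f t (b t))
    \<longleftrightarrow> b \<in> polymatroid E f"
proof -
  have fin: "finite E" using f by (rule rank_function_finite)
  have sum_restrict: "sum (restrict b (E - {t})) I = sum b I" if "I \<subseteq> E - {t}" for I
    using that by (intro sum.cong) auto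
  have sum_insert: "sum b (insert t I) = b t + sum b I" if "I \<subseteq> E - {t}" for I
  proof -
    have "finite I" "t \<notin> I" using that fin finite_subset[of I E] by auto
    then show ?thesis by simp
  qed
  \<comment> \<open>The lower bound \<open>alpha E f t \<le> b t\<close> makes
    \<open>f E - b t\<close> the smaller of the two terms, so the total-sum conditions
    match.\<close>
  have total: "slice_rank f t (b t) (E - {t}) = f E - b t"
    using bt insert_absorb[OF t] by (simp add: slice_rank_def T_range_def alpha_def)
  have sumE: "sum b E = b t + sum b (E - {t})"
    using sum_insert[of "E - {t}"] insert_absorb[OF t] by simp
  have "(\<forall>I\<subseteq>E. sum b I \<le> f I) \<longleftrightarrow>
      (\<forall>I\<subseteq>E - {t}. sum b I \<le> f I \<and> sum b (insert t I) \<le> f (insert t I))" (is "?L \<longleftrightarrow> ?R")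
  proof
    assume L: ?L
    show ?R
    proof (intro allI impI conjI)
      fix I assume "I \<subseteq> E - {t}"
      then have "I \<subseteq> E" "insert t I \<subseteq> E" using t by auto
      with L show "sum b I \<le> f I" "sum b (insert t I) \<le> f (insert t I)" by blast+
    qed
  next
    assume R: ?R
    show ?L
    proof (intro allI impI)
      fix I assume "I \<subseteq> E"
      show "sum b I \<le> f I"
      proof (cases "t \<in> I")
        case True
        have "I - {t} \<subseteq> E - {t}" using \<open>I \<subseteq> E\<close> by auto
        with R have "sum b (insert t (I - {t})) \<le> f (insert t (I - {t}))" by blast
        with True show ?thesis by (simp add: insert_absorb)
      next
        case False
        with \<open>I \<subseteq> E\<close> have "I \<subseteq> E - {t}" by auto
        with R show ?thesis by blast
      qed
    qed
  qed
  also have "\<dots> \<longleftrightarrow> (\<forall>I\<subseteq>E - {t}. sum b I \<le> slice_rank f t (b t) I)"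
    by (intro all_cong) (auto simp: slice_rank_def sum_insert)
  also have "\<dots> \<longleftrightarrow>
      (\<forall>I\<subseteq>E - {t}. sum (restrict b (E - {t})) I \<le> slice_rank f t (b t) I)"
    by (intro all_cong) (simp only: sum_restrict)
  finally have "(\<forall>I\<subseteq>E. sum b I \<le> f I) \<longleftrightarrow>
      (\<forall>I\<subseteq>E - {t}. sum (restrict b (E - {t})) I \<le> slice_rank f t (b t) I)" .
  moreover have "sum (restrict b (E - {t})) (E - {t}) = slice_rank f t (b t) (E - {t})
      \<longleftrightarrow> sum b E = f E"
    unfolding sum_restrict[OF order_refl] total sumE by linarith
  ultimately show ?thesis
    unfolding polymatroid_def mem_Collect_eq using b by (simp only:) simp
qed

lemma projected_slice_eq:
  assumes f: "rank_function E f" and t: "t \<in> E" and j: "j \<in> T_range E f t"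
  shows "projected_slice E (polymatroid E f) t j = polymatroid (E - {t}) (slice_rank f t j)"
proof (intro equalityI subsetI)
  fix c assume "c \<in> projected_slice E (polymatroid E f) t j"
  then obtain a where a: "a \<in> polymatroid E f" "a t = j" "c = restrict a (E - {t})"
    by (auto simp: projected_slice_def)
  then show "c \<in> polymatroid (E - {t}) (slice_rank f t j)"
    using restrict_mem_slice_iff[OF f t polymatroid_PiE, of a f] j by simp
next
  fix c assume c: "c \<in> polymatroid (E - {t}) (slice_rank f t j)"
  define a where "a = c(t := j)"
  have ext: "c \<in> E - {t} \<rightarrow>\<^sub>E UNIV" using c by (rule polymatroid_PiE)
  then have "a \<in> E \<rightarrow>\<^sub>E UNIV" using t by (auto simp: a_def PiE_iff extensional_def)
  moreover have res: "restrict a (E - {t}) = c"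
    using ext by (auto simp: a_def fun_eq_iff PiE_iff extensional_def restrict_def)
  ultimately have "a \<in> polymatroid E f"
    using restrict_mem_slice_iff[OF f t, of a] j c by (simp add: a_def)
  then have "a \<in> {a \<in> polymatroid E f. a t = j}" by (simp add: a_def)
  with res show "c \<in> projected_slice E (polymatroid E f) t j"
    unfolding projected_slice_def by blast
qed

text \<open>At the lower end submodularity for \<open>insert t I\<close> and \<open>E - {t}\<close>
  makes \<open>f I\<close> the smaller term of the minimum. At the upper end, in
  \<open>contraction_eq_slice\<close>, submodularity for \<open>I\<close> and \<open>{t}\<close>
  selects the other term.\<close>

lemma deletion_eq_slice:
  assumes f: "rank_function E f" and t: "t \<in> E"
  shows "deletion E f t = polymatroid (E - {t}) (slice_rank f t (alpha E f t))"
  unfolding deletion_def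
proof (rule polymatroid_cong)
  fix I assume "I \<subseteq> E - {t}"
  then have "f E + f I \<le> f (insert t I) + f (E - {t})"
    using t by (intro rank_function_submodular_eq[OF f]) auto
  then show "f I = slice_rank f t (alpha E f t) I"
    by (simp add: slice_rank_def alpha_def)
qed

lemma contraction_eq_slice:
  assumes f: "rank_function E f" and t: "t \<in> E"
  shows "contraction E f t = polymatroid (E - {t}) (slice_rank f t (beta f t))"
  unfolding contraction_def
proof (rule polymatroid_cong)
  fix I assume "I \<subseteq> E - {t}"
  then have "f (insert t I) + f {} \<le> f I + f {t}"
    using t by (intro rank_function_submodular_eq[OF f]) auto
  then show "f (I \<union> {t}) - f {t} = slice_rank f t (beta f t) I"
    using rank_function_empty[OF f] by (simp add: slice_rank_def beta_def)
qed

section \<open>Activity of the largest element\<close>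

text \<open>Sums are modular and \<open>f\<close> is submodular, so the slacks of the union and of
  the intersection are nonnegative with sum at most zero.\<close>

lemma tight_Un_Int:
  assumes f: "rank_function E f" and a: "a \<in> polymatroid E f"
    and I: "I \<subseteq> E" "sum a I = f I" and J: "J \<subseteq> E" "sum a J = f J"
  shows "sum a (I \<union> J) = f (I \<union> J)" "sum a (I \<inter> J) = f (I \<inter> J)"
proof -
  have "finite I" "finite J"
    using I J rank_function_finite[OF f] finite_subset by blast+
  then have "sum a (I \<union> J) + sum a (I \<inter> J) = f I + f J"
    using sum.union_inter[of I J a] I J by simp
  moreover have "sum a (I \<union> J) \<le> f (I \<union> J)" "sum a (I \<inter> J) \<le> f (I \<inter> J)"
    using I J by (auto intro!: polymatroid_sum_le[OF a])
  moreover have "f (I \<union> J) + f (I \<inter> J) \<le> f I + f J"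
    using rank_function_submodular[OF f I(1) J(1)] .
  ultimately show "sum a (I \<union> J) = f (I \<union> J)" "sum a (I \<inter> J) = f (I \<inter> J)"
    by linarith+
qed

text \<open>The exchange keeps the total and raises a subset sum by at most one, exactly when the
  subset contains \<open>j\<close> but not \<open>i\<close>. By integrality, a constraint violated
  afterwards was tight before.\<close>

lemma blocked_exchange_tight:
  assumes f: "rank_function E f" and a: "a \<in> polymatroid E f"
    and ij: "i \<in> E" "j \<in> E" "i \<noteq> j"
    and blocked: "a(i := a i - 1, j := a j + 1) \<notin> polymatroid E f"
  obtains I where "I \<subseteq> E" "j \<in> I" "i \<notin> I" "sum a I = f I"
proof -
  let ?b = "a(i := a i - 1, j := a j + 1)"
  have sum_b: "sum ?b I = sum a I + of_bool (j \<in> I) - of_bool (i \<in> I)" if "I \<subseteq> E" for I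
  proof -
    have fin: "finite I" using that rank_function_finite[OF f] finite_subset by blast
    have "sum ?b I = (\<Sum>k\<in>I. a k + of_bool (k = j) - of_bool (k = i))"
      by (intro sum.cong) (use ij in auto)
    also have "\<dots> = sum a I + of_bool (j \<in> I) - of_bool (i \<in> I)"
      using fin by (simp add: sum.distrib sum_subtractf of_bool_def)
    finally show ?thesis .
  qed
  have "?b \<in> E \<rightarrow>\<^sub>E UNIV"
    using polymatroid_PiE[OF a] ij by (auto simp: PiE_iff extensional_def)
  moreover have "sum ?b E = f E"
    using a ij sum_b[of E] by (simp add: polymatroid_def)
  ultimately obtain I where I: "I \<subseteq> E" "\<not> sum ?b I \<le> f I"
    using blocked unfolding polymatroid_def by blast
  have "sum a I \<le> f I" using a I(1) by (rule polymatroid_sum_le)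
  with I(2) sum_b[OF I(1)] have "j \<in> I" "i \<notin> I" "sum a I = f I"
    by (auto simp: of_bool_def split: if_splits)
  with I(1) show thesis using that by blast
qed

text \<open>If every exchange lowering \<open>a t\<close> is blocked, each
  \<open>j \<noteq> t\<close> lies in a tight set avoiding \<open>t\<close>. The union of these sets
  is \<open>E - {t}\<close>; its tightness says that \<open>a t\<close> is minimal.\<close>

lemma coord_eq_alpha_iff:
  assumes f: "rank_function E f" and a: "a \<in> polymatroid E f" and t: "t \<in> E"
  shows "a t = alpha E f t \<longleftrightarrow> (\<forall>j\<in>E - {t}. a(t := a t - 1, j := a j + 1) \<notin> polymatroid E f)"
proof
  assume eq: "a t = alpha E f t"
  show "\<forall>j\<in>E - {t}. a(t := a t - 1, j := a j + 1) \<notin> polymatroid E f"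
  proof (intro ballI notI)
    fix j assume j: "j \<in> E - {t}" and mem: "a(t := a t - 1, j := a j + 1) \<in> polymatroid E f"
    show False using polymatroid_coord_bounds(1)[OF f mem t] j eq by auto
  qed
next
  assume blocked: "\<forall>j\<in>E - {t}. a(t := a t - 1, j := a j + 1) \<notin> polymatroid E f"
  have fin: "finite E" using f by (rule rank_function_finite)
  have "\<exists>I. S \<subseteq> I \<and> I \<subseteq> E - {t} \<and> sum a I = f I" if "finite S" "S \<subseteq> E - {t}" for S
    using that
  proof (induction S rule: finite_induct)
    case empty
    show ?case using rank_function_empty[OF f] by (intro exI[of _ "{}"]) auto
  next
    case (insert j S)
    then obtain I where I: "S \<subseteq> I" "I \<subseteq> E - {t}" "sum a I = f I" by auto
    obtain J where J: "J \<subseteq> E" "j \<in> J" "t \<notin> J" "sum a J = f J"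
      using blocked_exchange_tight[OF f a t, of j] insert.prems blocked by auto
    have "sum a (I \<union> J) = f (I \<union> J)"
      using tight_Un_Int(1)[OF f a _ I(3) J(1) J(4)] I(2) by auto
    then show ?case using I J by (intro exI[of _ "I \<union> J"]) auto
  qed
  from this[of "E - {t}"] fin have "sum a (E - {t}) = f (E - {t})" by fastforce
  moreover have "sum a E = a t + sum a (E - {t})" using fin t by (rule sum.remove)
  moreover have "sum a E = f E" using a by (simp add: polymatroid_def)
  ultimately show "a t = alpha E f t" by (simp add: alpha_def)
qed

text \<open>Dual to the minimal case: each \<open>j \<noteq> t\<close> is avoided by a tight set
  containing \<open>t\<close>, and intersecting these sets, starting from the tight set
  \<open>E\<close>, leaves the tight set \<open>{t}\<close>.\<close>

lemma coord_eq_beta_iff: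
  assumes f: "rank_function E f" and a: "a \<in> polymatroid E f" and t: "t \<in> E"
  shows "a t = beta f t \<longleftrightarrow> (\<forall>j\<in>E - {t}. a(t := a t + 1, j := a j - 1) \<notin> polymatroid E f)"
proof
  assume eq: "a t = beta f t"
  show "\<forall>j\<in>E - {t}. a(t := a t + 1, j := a j - 1) \<notin> polymatroid E f"
  proof (intro ballI notI)
    fix j assume j: "j \<in> E - {t}" and mem: "a(t := a t + 1, j := a j - 1) \<in> polymatroid E f"
    show False using polymatroid_coord_bounds(2)[OF f mem t] j eq by auto
  qed
next
  assume blocked: "\<forall>j\<in>E - {t}. a(t := a t + 1, j := a j - 1) \<notin> polymatroid E f"
  have fin: "finite E" using f by (rule rank_function_finite)
  have "\<exists>I. t \<in> I \<and> I \<subseteq> E - S \<and> sum a I = f I" if "finite S" "S \<subseteq> E - {t}" for S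
    using that
  proof (induction S rule: finite_induct)
    case empty
    show ?case using a t by (intro exI[of _ E]) (auto simp: polymatroid_def)
  next
    case (insert j S)
    then obtain I where I: "t \<in> I" "I \<subseteq> E - S" "sum a I = f I" by auto
    have j: "j \<in> E" "j \<noteq> t" using insert.prems by auto
    have "a(j := a j - 1, t := a t + 1) \<notin> polymatroid E f"
      using blocked j fun_upd_twist[of j t a] by auto
    then obtain J where J: "J \<subseteq> E" "t \<in> J" "j \<notin> J" "sum a J = f J"
      using blocked_exchange_tight[OF f a j(1) t j(2)] by blast
    have "sum a (I \<inter> J) = f (I \<inter> J)"
      using tight_Un_Int(2)[OF f a _ I(3) J(1) J(4)] I(2) by auto
    then show ?case using I J by (intro exI[of _ "I \<inter> J"]) auto
  qed
  from this[of "E - {t}"] fin obtain I where I: "t \<in> I" "I \<subseteq> E - (E - {t})" "sum a I = f I"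
    by auto
  then have "I = {t}" by auto
  with I show "a t = beta f t" by (simp add: beta_def)
qed

text \<open>For the largest element the restriction to smaller \<open>j\<close> in the definition of
  activity admits every other element, which is the exchange condition of
  \<open>coord_eq_alpha_iff\<close>.\<close>

lemma Max_mem_Int_act_iff:
  assumes f: "rank_function E f" and a: "a \<in> polymatroid E f" and E: "E \<noteq> {}"
  shows "Max E \<in> Int_act E (polymatroid E f) a \<longleftrightarrow> a (Max E) = alpha E f (Max E)"
proof -
  have fin: "finite E" using f by (rule rank_function_finite)
  have "j < Max E \<longleftrightarrow> j \<in> E - {Max E}" if "j \<in> E" for j
    using that fin by (auto simp: order.strict_iff_order)
  moreover have "Max E \<in> E" using fin E by simp
  ultimately show ?thesis
    unfolding coord_eq_alpha_iff[OF f a \<open>Max E \<in> E\<close>] Int_act_def by auto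
qed

lemma Max_mem_Ext_act_iff:
  assumes f: "rank_function E f" and a: "a \<in> polymatroid E f" and E: "E \<noteq> {}"
  shows "Max E \<in> Ext_act E (polymatroid E f) a \<longleftrightarrow> a (Max E) = beta f (Max E)"
proof -
  have fin: "finite E" using f by (rule rank_function_finite)
  have "j < Max E \<longleftrightarrow> j \<in> E - {Max E}" if "j \<in> E" for j
    using that fin by (auto simp: order.strict_iff_order)
  moreover have "Max E \<in> E" using fin E by simp
  ultimately show ?thesis
    unfolding coord_eq_beta_iff[OF f a \<open>Max E \<in> E\<close>] Ext_act_def by auto
qed

section \<open>Activity of the smaller elements, read off in a slice\<close>

lemma upd_mem_slice_iff:
  assumes f: "rank_function E f" and a: "a \<in> polymatroid E f" and t: "t \<in> E"
    and ij: "i \<in> E - {t}" "j \<in> E - {t}"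
  shows "(restrict a (E - {t}))(i := r, j := s) \<in> polymatroid (E - {t}) (slice_rank f t (a t))
    \<longleftrightarrow> a(i := r, j := s) \<in> polymatroid E f"
proof -
  let ?b = "a(i := r, j := s)"
  have "?b t = a t" using ij by auto
  moreover have "(restrict a (E - {t}))(i := r, j := s) = restrict ?b (E - {t})"
    using ij by (auto simp: fun_eq_iff)
  moreover have "?b \<in> E \<rightarrow>\<^sub>E UNIV"
    using polymatroid_PiE[OF a] ij by (auto simp: PiE_iff extensional_def)
  moreover have "a t \<in> T_range E f t"
    using polymatroid_coord_bounds[OF f a t] by (simp add: T_range_def)
  ultimately show ?thesis using restrict_mem_slice_iff[OF f t, of ?b] by simp
qed

text \<open>An element below \<open>Max E\<close> is tested against still smaller ones, so none of
  its exchanges moves the coordinate at \<open>Max E\<close>, and all of them stay in the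
  slice.\<close>

lemma Int_act_slice:
  assumes f: "rank_function E f" and a: "a \<in> polymatroid E f" and E: "E \<noteq> {}"
  defines "t \<equiv> Max E"
  shows "Int_act (E - {t}) (polymatroid (E - {t}) (slice_rank f t (a t))) (restrict a (E - {t}))
    = Int_act E (polymatroid E f) a - {t}"
proof -
  have fin: "finite E" using f by (rule rank_function_finite)
  have t: "t \<in> E" using fin E by (simp add: t_def)
  have le: "i \<le> t" if "i \<in> E" for i using that fin by (simp add: t_def)
  let ?P = "polymatroid E f" and ?Q = "polymatroid (E - {t}) (slice_rank f t (a t))"
  let ?a = "restrict a (E - {t})"
  have upd: "?a(i := ?a i - 1, j := ?a j + 1) \<in> ?Q \<longleftrightarrow> a(i := a i - 1, j := a j + 1) \<in> ?P"
    if "i \<in> E - {t}" "j \<in> E - {t}" for i j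
    using upd_mem_slice_iff[OF f a t that] that by simp
  have "i \<in> Int_act (E - {t}) ?Q ?a \<longleftrightarrow> i \<in> Int_act E ?P a" if i: "i \<in> E - {t}" for i
  proof -
    have "i \<in> Int_act (E - {t}) ?Q ?a \<longleftrightarrow>
        (\<forall>j\<in>E - {t}. j < i \<longrightarrow> a(i := a i - 1, j := a j + 1) \<notin> ?P)"
      unfolding Int_act_def mem_Collect_eq using i upd[OF i] by (simp only:) blast
    also have "\<dots> \<longleftrightarrow> i \<in> Int_act E ?P a"
      unfolding Int_act_def mem_Collect_eq using i le[of i] by auto
    finally show ?thesis .
  qed
  moreover have "Int_act (E - {t}) ?Q ?a \<subseteq> E - {t}" "Int_act E ?P a \<subseteq> E"
    by (auto simp: Int_act_def)
  ultimately show ?thesis by blast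
qed

lemma Ext_act_slice:
  assumes f: "rank_function E f" and a: "a \<in> polymatroid E f" and E: "E \<noteq> {}"
  defines "t \<equiv> Max E"
  shows "Ext_act (E - {t}) (polymatroid (E - {t}) (slice_rank f t (a t))) (restrict a (E - {t}))
    = Ext_act E (polymatroid E f) a - {t}"
proof -
  have fin: "finite E" using f by (rule rank_function_finite)
  have t: "t \<in> E" using fin E by (simp add: t_def)
  have le: "i \<le> t" if "i \<in> E" for i using that fin by (simp add: t_def)
  let ?P = "polymatroid E f" and ?Q = "polymatroid (E - {t}) (slice_rank f t (a t))"
  let ?a = "restrict a (E - {t})"
  have upd: "?a(i := ?a i + 1, j := ?a j - 1) \<in> ?Q \<longleftrightarrow> a(i := a i + 1, j := a j - 1) \<in> ?P"
    if "i \<in> E - {t}" "j \<in> E - {t}" for i j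
    using upd_mem_slice_iff[OF f a t that] that by simp
  have "i \<in> Ext_act (E - {t}) ?Q ?a \<longleftrightarrow> i \<in> Ext_act E ?P a" if i: "i \<in> E - {t}" for i
  proof -
    have "i \<in> Ext_act (E - {t}) ?Q ?a \<longleftrightarrow>
        (\<forall>j\<in>E - {t}. j < i \<longrightarrow> a(i := a i + 1, j := a j - 1) \<notin> ?P)"
      unfolding Ext_act_def mem_Collect_eq using i upd[OF i] by (simp only:) blast
    also have "\<dots> \<longleftrightarrow> i \<in> Ext_act E ?P a"
      unfolding Ext_act_def mem_Collect_eq using i le[of i] by auto
    finally show ?thesis .
  qed
  moreover have "Ext_act (E - {t}) ?Q ?a \<subseteq> E - {t}" "Ext_act E ?P a \<subseteq> E"
    by (auto simp: Ext_act_def)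
  ultimately show ?thesis by blast
qed

section \<open>The recursion at the largest element\<close>

text \<open>Written additively, the weight needs no case distinction: if \<open>p\<close> and \<open>q\<close> both
  hold it is \<open>x + y - 1\<close>.\<close>

definition act_weight :: "bool \<Rightarrow> bool \<Rightarrow> int poly poly" where
  "act_weight p q = 1 + (var_x - 1) * of_bool p + (var_y - 1) * of_bool q"

lemma prod_act_weight:
  assumes "finite E"
  shows "(\<Prod>i\<in>E. act_weight (i \<in> I) (i \<in> X)) =
    var_x ^ card ((I - X) \<inter> E) * var_y ^ card ((X - I) \<inter> E) *
    (var_x + var_y - 1) ^ card (I \<inter> X \<inter> E)"
  using assms
proof (induction E rule: finite_induct)
  case (insert i E)
  show ?case
    by (cases "i \<in> I"; cases "i \<in> X")
      (use insert in \<open>simp_all add: act_weight_def Int_insert_right algebra_simps\<close>)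
qed simp

text \<open>The monomial of a basis, written as a product with one factor per element so that the
  factor of \<open>Max E\<close> can be split off.\<close>

definition basis_weight :: "nat set \<Rightarrow> (nat \<Rightarrow> int) set \<Rightarrow> (nat \<Rightarrow> int) \<Rightarrow> int poly poly" where
  "basis_weight E P a = (\<Prod>i\<in>E. act_weight (i \<in> Int_act E P a) (i \<in> Ext_act E P a))"

lemma tutte_eq_sum_basis_weight:
  assumes "finite E"
  shows "tutte E P = (\<Sum>a\<in>P. basis_weight E P a)"
proof -
  have "basis_weight E P a = var_x ^ oi E P a * var_y ^ oe E P a * (var_x + var_y - 1) ^ ie E P a"
    for a
  proof -
    have sub: "Int_act E P a \<subseteq> E" "Ext_act E P a \<subseteq> E"
      by (auto simp: Int_act_def Ext_act_def)
    then have "(Int_act E P a - Ext_act E P a) \<inter> E = Int_act E P a - Ext_act E P a"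
      "(Ext_act E P a - Int_act E P a) \<inter> E = Ext_act E P a - Int_act E P a"
      "Int_act E P a \<inter> Ext_act E P a \<inter> E = Int_act E P a \<inter> Ext_act E P a"
      by auto
    then show ?thesis
      unfolding basis_weight_def prod_act_weight[OF assms] oi_def oe_def ie_def by simp
  qed
  then show ?thesis by (simp add: tutte_def)
qed

text \<open>The right-hand side of the recursion at \<open>t\<close>, with both cases in one
  formula: the weight is \<open>x\<close> at the lower end, \<open>y\<close> at the upper end, 1 in
  between, and \<open>x + y - 1\<close> when the ends coincide.\<close>

definition slice_sum :: "nat set \<Rightarrow> (nat set \<Rightarrow> int) \<Rightarrow> nat \<Rightarrow> int poly poly" where
  "slice_sum E f t = (\<Sum>j\<in>T_range E f t. act_weight (j = alpha E f t) (j = beta f t) *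
     tutte (E - {t}) (polymatroid (E - {t}) (slice_rank f t j)))"

lemma tutte_eq_slice_sum_Max:
  assumes f: "rank_function E f" and E: "E \<noteq> {}"
  shows "tutte E (polymatroid E f) = slice_sum E f (Max E)"
proof -
  define t where "t = Max E"
  define P where "P = polymatroid E f"
  define Q where "Q j = polymatroid (E - {t}) (slice_rank f t j)" for j
  define w where "w j = act_weight (j = alpha E f t) (j = beta f t)" for j
  have fin: "finite E" using f by (rule rank_function_finite)
  have t: "t \<in> E" using fin E by (simp add: t_def)
  have weight: "basis_weight E P a = w (a t) * basis_weight (E - {t}) (Q (a t)) (restrict a (E - {t}))"
    if "a \<in> P" for a
  proof -
    have a: "a \<in> polymatroid E f" using that by (simp add: P_def)
    have "basis_weight E P a = act_weight (t \<in> Int_act E P a) (t \<in> Ext_act E P a) *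
        (\<Prod>i\<in>E - {t}. act_weight (i \<in> Int_act E P a) (i \<in> Ext_act E P a))"
      unfolding basis_weight_def using fin t by (rule prod.remove)
    also have "act_weight (t \<in> Int_act E P a) (t \<in> Ext_act E P a) = w (a t)"
      using Max_mem_Int_act_iff[OF f a E] Max_mem_Ext_act_iff[OF f a E]
      by (simp add: w_def P_def t_def)
    also have "(\<Prod>i\<in>E - {t}. act_weight (i \<in> Int_act E P a) (i \<in> Ext_act E P a)) =
        basis_weight (E - {t}) (Q (a t)) (restrict a (E - {t}))"
      unfolding basis_weight_def
    proof (intro prod.cong refl)
      fix i assume "i \<in> E - {t}"
      then show "act_weight (i \<in> Int_act E P a) (i \<in> Ext_act E P a) =
          act_weight (i \<in> Int_act (E - {t}) (Q (a t)) (restrict a (E - {t})))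
            (i \<in> Ext_act (E - {t}) (Q (a t)) (restrict a (E - {t})))"
        unfolding Q_def P_def t_def Int_act_slice[OF f a E] Ext_act_slice[OF f a E] by simp
    qed
    finally show ?thesis .
  qed
  have "tutte E P = (\<Sum>a\<in>P. basis_weight E P a)"
    using fin by (rule tutte_eq_sum_basis_weight)
  \<comment> \<open>Bases are grouped by their value at \<open>t\<close>; inside a group the factor
    of \<open>t\<close> is constant.\<close>
  also have "\<dots> = (\<Sum>j\<in>T_range E f t. \<Sum>a\<in>{a \<in> P. a t = j}. basis_weight E P a)"
    using finite_polymatroid[OF f] polymatroid_coord_bounds[OF f _ t]
    by (intro sum.group[symmetric]) (auto simp: P_def T_range_def)
  also have "\<dots> = (\<Sum>j\<in>T_range E f t. w j * tutte (E - {t}) (Q j))"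
  proof (intro sum.cong refl)
    fix j assume j: "j \<in> T_range E f t"
    have inj: "inj_on (\<lambda>a. restrict a (E - {t})) {a \<in> P. a t = j}"
    proof (rule inj_onI)
      fix a b assume ab: "a \<in> {a \<in> P. a t = j}" "b \<in> {a \<in> P. a t = j}"
        "restrict a (E - {t}) = restrict b (E - {t})"
      show "a = b"
      proof
        fix i show "a i = b i"
          using ab(1,2) fun_cong[OF ab(3), of i] polymatroid_PiE[of _ E f]
          by (cases "i = t"; cases "i \<in> E")
            (auto simp: P_def restrict_def PiE_iff extensional_def, metis)
      qed
    qed
    have "Q j = (\<lambda>a. restrict a (E - {t})) ` {a \<in> P. a t = j}"
      using projected_slice_eq[OF f t j] by (simp add: projected_slice_def Q_def P_def)
    then have "tutte (E - {t}) (Q j) =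
        (\<Sum>a\<in>{a \<in> P. a t = j}. basis_weight (E - {t}) (Q j) (restrict a (E - {t})))"
      using fin inj by (subst tutte_eq_sum_basis_weight) (simp_all add: sum.reindex)
    then show "(\<Sum>a\<in>{a \<in> P. a t = j}. basis_weight E P a) = w j * tutte (E - {t}) (Q j)"
      using weight by (simp add: sum_distrib_left)
  qed
  finally show ?thesis by (simp add: slice_sum_def t_def P_def Q_def w_def)
qed

section \<open>Interchanging two slicing steps\<close>

text \<open>Here \<open>a\<close>, \<open>b\<close> stand for the first coordinate being at its
  lower or upper end, \<open>a'\<close>, \<open>b'\<close> for the same of the second, and
  \<open>p\<close>, \<open>q\<close> for lying on the lower or upper diagonal edge. Off both edges
  the two products agree by commutativity. On the lower edge alone, away from the upper ends, each
  product has a factor \<open>x\<close>, which leaves \<open>(x - 1) * x\<close> times the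
  difference of the two end indicators; the upper edge is analogous.\<close>

lemma weight_swap:
  fixes x y :: "'a::comm_ring_1"
  assumes "p \<and> b \<longrightarrow> a'" "p \<and> b' \<longrightarrow> a" "q \<and> a \<longrightarrow> b'" "q \<and> a' \<longrightarrow> b"
  shows "(1 + (x - 1) * of_bool a + (y - 1) * of_bool b) *
        (1 + (x - 1) * of_bool (a' \<or> p) + (y - 1) * of_bool (b' \<or> q)) -
      (1 + (x - 1) * of_bool a' + (y - 1) * of_bool b') *
        (1 + (x - 1) * of_bool (a \<or> p) + (y - 1) * of_bool (b \<or> q)) =
    (x - 1) * x * (of_bool (p \<and> a) - of_bool (p \<and> a')) +
    (y - 1) * y * (of_bool (q \<and> b) - of_bool (q \<and> b'))"
  using assms
  by (cases p; cases q; cases a; cases b; cases a'; cases b'; simp; (simp add: algebra_simps; fail)?)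

text \<open>The pairs \<open>(j, k)\<close> run through a hexagon with diagonal edges \<open>j + k = c\<close> and
  \<open>j + k = d\<close>; the hypotheses on \<open>c\<close> and \<open>d\<close> make every row, column and diagonal edge nonempty.\<close>

lemma hexagon_sum_swap:
  fixes A B A' B' c d :: int and F :: "int \<Rightarrow> int \<Rightarrow> int poly poly"
  assumes AB: "A \<le> B" "A' \<le> B'" and cd: "c \<le> d"
    and c: "A + A' \<le> c" "c \<le> A + B'" "c \<le> A' + B"
    and d: "d \<le> B + B'" "A' + B \<le> d" "A + B' \<le> d"
    and Fc: "F A (c - A) = F (c - A') A'"
    and Fd: "F B (d - B) = F (d - B') B'"
  shows "(\<Sum>j\<in>{A..B}. act_weight (j = A) (j = B) *
      (\<Sum>k\<in>{max A' (c - j)..min B' (d - j)}.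
        act_weight (k = max A' (c - j)) (k = min B' (d - j)) * F j k)) =
    (\<Sum>k\<in>{A'..B'}. act_weight (k = A') (k = B') *
      (\<Sum>j\<in>{max A (c - k)..min B (d - k)}.
        act_weight (j = max A (c - k)) (j = min B (d - k)) * F j k))"
    (is "?L = ?R")
proof -
  \<comment> \<open>The hexagon itself: both iterated sums range over it, so the weights can be
    compared pointwise.\<close>
  define H where "H = {(j, k). j \<in> {A..B} \<and> k \<in> {A'..B'} \<and> c \<le> j + k \<and> j + k \<le> d}"
  have "H \<subseteq> {A..B} \<times> {A'..B'}" by (auto simp: H_def)
  then have finH: "finite H" by (rule finite_subset) simp
  define L where "L j k = act_weight (j = A) (j = B) *
    act_weight (k = max A' (c - j)) (k = min B' (d - j))" for j k
  define R where "R j k = act_weight (k = A') (k = B') *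
    act_weight (j = max A (c - k)) (j = min B (d - k))" for j k
  define u v where "u = (var_x - 1) * var_x" and "v = (var_y - 1) * var_y"
  have "?L = (\<Sum>j\<in>{A..B}. \<Sum>k\<in>{max A' (c - j)..min B' (d - j)}. L j k * F j k)"
    by (simp add: L_def sum_distrib_left mult.assoc)
  also have "\<dots> = (\<Sum>(j, k)\<in>(SIGMA j:{A..B}. {max A' (c - j)..min B' (d - j)}). L j k * F j k)"
    by (rule sum.Sigma) auto
  also have "(SIGMA j:{A..B}. {max A' (c - j)..min B' (d - j)}) = H"
    by (auto simp: H_def)
  finally have L: "?L = (\<Sum>(j, k)\<in>H. L j k * F j k)" .
  have "?R = (\<Sum>k\<in>{A'..B'}. \<Sum>j\<in>{max A (c - k)..min B (d - k)}. R j k * F j k)"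
    by (simp add: R_def sum_distrib_left mult.assoc)
  also have "\<dots> = (\<Sum>(k, j)\<in>(SIGMA k:{A'..B'}. {max A (c - k)..min B (d - k)}). R j k * F j k)"
    by (rule sum.Sigma) auto
  also have "\<dots> = (\<Sum>(j, k)\<in>H. R j k * F j k)"
    by (rule sum.reindex_bij_witness[of _ prod.swap prod.swap]) (auto simp: H_def)
  finally have R: "?R = (\<Sum>(j, k)\<in>H. R j k * F j k)" .
  have diff: "L j k * F j k - R j k * F j k =
      u * (of_bool ((j, k) = (A, c - A)) * F j k - of_bool ((j, k) = (c - A', A')) * F j k) +
      v * (of_bool ((j, k) = (B, d - B)) * F j k - of_bool ((j, k) = (d - B', B')) * F j k)"
    if "(j, k) \<in> H" for j k
  proof -
    let ?p = "j + k = c" and ?q = "j + k = d"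
    have jk: "A \<le> j" "j \<le> B" "A' \<le> k" "k \<le> B'" "c \<le> j + k" "j + k \<le> d"
      using that by (auto simp: H_def)
    have L_eq: "L j k = act_weight (j = A) (j = B) * act_weight (k = A' \<or> ?p) (k = B' \<or> ?q)"
    proof -
      have "k = max A' (c - j) \<longleftrightarrow> k = A' \<or> ?p" "k = min B' (d - j) \<longleftrightarrow> k = B' \<or> ?q"
        using jk by linarith+
      then show ?thesis by (simp add: L_def)
    qed
    have R_eq: "R j k = act_weight (k = A') (k = B') * act_weight (j = A \<or> ?p) (j = B \<or> ?q)"
    proof -
      have "j = max A (c - k) \<longleftrightarrow> j = A \<or> ?p" "j = min B (d - k) \<longleftrightarrow> j = B \<or> ?q"
        using jk by linarith+
      then show ?thesis by (simp add: R_def)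
    qed
    have ends: "(j, k) = (A, c - A) \<longleftrightarrow> ?p \<and> j = A" "(j, k) = (c - A', A') \<longleftrightarrow> ?p \<and> k = A'"
      "(j, k) = (B, d - B) \<longleftrightarrow> ?q \<and> j = B" "(j, k) = (d - B', B') \<longleftrightarrow> ?q \<and> k = B'"
      by auto
    \<comment> \<open>Since the edges are bounded by \<open>c \<le> A' + B\<close> and its
      analogues, an edge point at the far end of one coordinate is at the near end of the
      other.\<close>
    have corners: "?p \<and> j = B \<longrightarrow> k = A'" "?p \<and> k = B' \<longrightarrow> j = A"
      "?q \<and> j = A \<longrightarrow> k = B'" "?q \<and> k = A' \<longrightarrow> j = B"
      using jk c d by linarith+
    have "L j k - R j k = u * (of_bool (?p \<and> j = A) - of_bool (?p \<and> k = A')) +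
        v * (of_bool (?q \<and> j = B) - of_bool (?q \<and> k = B'))"
      unfolding L_eq R_eq u_def v_def act_weight_def using corners by (intro weight_swap)
    then have "(L j k - R j k) * F j k =
        (u * (of_bool (?p \<and> j = A) - of_bool (?p \<and> k = A')) +
         v * (of_bool (?q \<and> j = B) - of_bool (?q \<and> k = B'))) * F j k" by simp
    then show ?thesis unfolding ends by (simp only: algebra_simps)
  qed
  have point: "(\<Sum>(j, k)\<in>H. of_bool ((j, k) = (j0, k0)) * F j k) = F j0 k0"
    if "(j0, k0) \<in> H" for j0 k0
  proof -
    have "(\<Sum>(j, k)\<in>H. of_bool ((j, k) = (j0, k0)) * F j k) =
        (\<Sum>z\<in>H. if z = (j0, k0) then F j0 k0 else 0)"
      by (intro sum.cong) (auto split: prod.splits)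
    also have "\<dots> = F j0 k0" using finH that by simp
    finally show ?thesis .
  qed
  \<comment> \<open>The surviving terms sit at the two endpoints of each diagonal edge, with
    opposite signs; \<open>Fc\<close> and \<open>Fd\<close> make them cancel.\<close>
  have mem: "(A, c - A) \<in> H" "(c - A', A') \<in> H" "(B, d - B) \<in> H" "(d - B', B') \<in> H"
    using AB cd c d by (auto simp: H_def)
  have "?L - ?R = (\<Sum>(j, k)\<in>H. L j k * F j k - R j k * F j k)"
    unfolding L R by (simp add: sum_subtractf case_prod_beta)
  also have "\<dots> = (\<Sum>(j, k)\<in>H.
      u * (of_bool ((j, k) = (A, c - A)) * F j k - of_bool ((j, k) = (c - A', A')) * F j k) +
      v * (of_bool ((j, k) = (B, d - B)) * F j k - of_bool ((j, k) = (d - B', B')) * F j k))"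
    by (intro sum.cong refl) (use diff in auto)
  also have "\<dots> =
      u * ((\<Sum>(j, k)\<in>H. of_bool ((j, k) = (A, c - A)) * F j k) -
           (\<Sum>(j, k)\<in>H. of_bool ((j, k) = (c - A', A')) * F j k)) +
      v * ((\<Sum>(j, k)\<in>H. of_bool ((j, k) = (B, d - B)) * F j k) -
           (\<Sum>(j, k)\<in>H. of_bool ((j, k) = (d - B', B')) * F j k))"
    unfolding case_prod_beta sum.distrib sum_subtractf sum_distrib_left[symmetric] by simp
  also have "\<dots> = 0"
    unfolding point[OF mem(1)] point[OF mem(2)] point[OF mem(3)] point[OF mem(4)] Fc Fd by simp
  finally show ?thesis by simp
qed

text \<open>As \<open>k\<close> is at least the minimum at \<open>t\<close>, the slice rank of
  \<open>E - {t}\<close> is \<open>f E - k\<close>; subtracting the minimum that defines the slice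
  rank of \<open>E - {t} - {s}\<close> produces a maximum. This is the lower end of a row of the
  hexagon.\<close>

lemma alpha_slice:
  assumes "s \<in> E" "s \<noteq> t" "t \<in> E" "k \<in> T_range E f t"
  shows "alpha (E - {t}) (slice_rank f t k) s = max (alpha E f s) (f E - f (E - {s, t}) - k)"
proof -
  have "insert t (E - {t}) = E" "insert t (E - {t} - {s}) = E - {s}" "E - {t} - {s} = E - {s, t}"
    using assms by auto
  then show ?thesis
    using assms(4) by (auto simp: alpha_def slice_rank_def T_range_def)
qed

lemma beta_slice: "beta (slice_rank f t k) s = min (beta f s) (f {s, t} - k)"
  by (simp add: beta_def slice_rank_def insert_commute)

text \<open>On the upper diagonal edge, submodularity against \<open>{s, t}\<close> makes the last
  of the four terms of the double slice rank the smallest. The double slice is then the contraction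
  of both elements, whatever \<open>j\<close> and \<open>k\<close> are.\<close>

lemma double_slice_top:
  assumes f: "rank_function E f" and st: "s \<in> E" "t \<in> E" and I: "I \<subseteq> E - {s, t}"
    and jk: "j \<le> beta f s" "k \<le> beta f t" "j + k = f {s, t}"
  shows "slice_rank (slice_rank f s j) t k I = f (insert s (insert t I)) - f {s, t}"
proof -
  let ?g = "f (insert s (insert t I))"
  note sub = rank_function_submodular_eq[OF f]
  have "?g + f {} \<le> f I + f {s, t}" by (rule sub) (use st I in auto)
  moreover have "?g + f {s} \<le> f (insert s I) + f {s, t}" if "s \<noteq> t"
    by (rule sub) (use that st I in auto)
  moreover have "?g + f {t} \<le> f (insert t I) + f {s, t}" if "s \<noteq> t"
    by (rule sub) (use that st I in auto)
  ultimately show ?thesis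
    using jk rank_function_empty[OF f]
    by (cases "s = t") (auto simp: slice_rank_def beta_def min_def)
qed

text \<open>On the lower diagonal edge, submodularity against \<open>E - {s, t}\<close> makes
  \<open>f I\<close> the smallest of the four terms, so the double slice is the deletion of both
  elements.\<close>

lemma double_slice_bottom:
  assumes f: "rank_function E f" and st: "s \<in> E" "t \<in> E" "s \<noteq> t" and I: "I \<subseteq> E - {s, t}"
    and jk: "alpha E f s \<le> j" "alpha E f t \<le> k" "j + k = f E - f (E - {s, t})"
  shows "slice_rank (slice_rank f s j) t k I = f I"
proof -
  note sub = rank_function_submodular_eq[OF f]
  have "f E + f I \<le> f (insert s (insert t I)) + f (E - {s, t})"
    by (rule sub) (use st I in auto)
  moreover have "f (E - {t}) + f I \<le> f (insert s I) + f (E - {s, t})"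
    by (rule sub) (use st I in auto)
  moreover have "f (E - {s}) + f I \<le> f (insert t I) + f (E - {s, t})"
    by (rule sub) (use st I in auto)
  ultimately show ?thesis
    using jk by (auto simp: slice_rank_def alpha_def min_def)
qed

lemma double_slice_sum_swap:
  assumes f: "rank_function E f" and st: "s \<in> E" "t \<in> E" "s \<noteq> t"
  shows "(\<Sum>j\<in>T_range E f s. act_weight (j = alpha E f s) (j = beta f s) *
      slice_sum (E - {s}) (slice_rank f s j) t) =
    (\<Sum>k\<in>T_range E f t. act_weight (k = alpha E f t) (k = beta f t) *
      slice_sum (E - {t}) (slice_rank f t k) s)"
proof -
  \<comment> \<open>For a basis \<open>a\<close>, the sum \<open>a s + a t\<close> lies between
    \<open>c\<close> and \<open>d\<close>: the lower bound comes from the constraint on the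
    complement, the upper one from the constraint on \<open>{s, t}\<close>. These give the diagonal
    edges.\<close>
  define c where "c = f E - f (E - {s, t})"
  define d where "d = f {s, t}"
  define F where "F j k = tutte (E - {s, t})
    (polymatroid (E - {s, t}) (slice_rank (slice_rank f s j) t k))" for j k
  have sets: "E - {s} - {t} = E - {s, t}" "E - {t} - {s} = E - {s, t}" "{t, s} = {s, t}" by auto
  note sub = rank_function_submodular_eq[OF f]
  have AB: "alpha E f s \<le> beta f s" "alpha E f t \<le> beta f t"
    using alpha_le_beta[OF f] st by auto
  have cd: "c \<le> d"
  proof -
    have "f E + f {} \<le> f (E - {s, t}) + f {s, t}" by (rule sub) (use st in auto)
    then show ?thesis using rank_function_empty[OF f] by (simp add: c_def d_def)
  qed
  have "f E + f (E - {s, t}) \<le> f (E - {s}) + f (E - {t})" by (rule sub) (use st in auto)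
  then have c1: "alpha E f s + alpha E f t \<le> c" by (simp add: c_def alpha_def)
  have "f (E - {s}) + f {} \<le> f (E - {s, t}) + f {t}" by (rule sub) (use st in auto)
  then have c2: "c \<le> alpha E f s + beta f t"
    using rank_function_empty[OF f] by (simp add: c_def alpha_def beta_def)
  have "f (E - {t}) + f {} \<le> f (E - {s, t}) + f {s}" by (rule sub) (use st in auto)
  then have c3: "c \<le> alpha E f t + beta f s"
    using rank_function_empty[OF f] by (simp add: c_def alpha_def beta_def)
  have "f {s, t} + f {} \<le> f {s} + f {t}" by (rule sub) (use st in auto)
  then have d1: "d \<le> beta f s + beta f t"
    using rank_function_empty[OF f] by (simp add: d_def beta_def)
  have "f E + f {s} \<le> f (E - {t}) + f {s, t}" by (rule sub) (use st in auto)
  then have d2: "alpha E f t + beta f s \<le> d" by (simp add: d_def alpha_def beta_def)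
  have "f E + f {t} \<le> f (E - {s}) + f {s, t}" by (rule sub) (use st in auto)
  then have d3: "alpha E f s + beta f t \<le> d" by (simp add: d_def alpha_def beta_def)
  have "F j k = tutte (E - {s, t}) (polymatroid (E - {s, t}) f)"
    if "alpha E f s \<le> j" "alpha E f t \<le> k" "j + k = c" for j k
    unfolding F_def
    using double_slice_bottom[OF f st] that c_def
    by (intro arg_cong[where f = "tutte (E - {s, t})"] polymatroid_cong) simp
  then have Fc: "F (alpha E f s) (c - alpha E f s) = F (c - alpha E f t) (alpha E f t)"
    using c1 by simp
  have "F j k = tutte (E - {s, t})
      (polymatroid (E - {s, t}) (\<lambda>I. f (insert s (insert t I)) - f {s, t}))"
    if "j \<le> beta f s" "k \<le> beta f t" "j + k = d" for j k
    unfolding F_def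
    using double_slice_top[OF f st(1,2)] that d_def
    by (intro arg_cong[where f = "tutte (E - {s, t})"] polymatroid_cong) simp
  then have Fd: "F (beta f s) (d - beta f s) = F (d - beta f t) (beta f t)"
    using d1 by simp
  have L: "slice_sum (E - {s}) (slice_rank f s j) t =
      (\<Sum>k\<in>{max (alpha E f t) (c - j)..min (beta f t) (d - j)}.
        act_weight (k = max (alpha E f t) (c - j)) (k = min (beta f t) (d - j)) * F j k)"
    if "j \<in> T_range E f s" for j
    unfolding slice_sum_def T_range_def beta_slice sets
      alpha_slice[OF st(2) st(3)[symmetric] st(1) that]
    by (simp add: F_def c_def d_def)
  have R: "slice_sum (E - {t}) (slice_rank f t k) s =
      (\<Sum>j\<in>{max (alpha E f s) (c - k)..min (beta f s) (d - k)}.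
        act_weight (j = max (alpha E f s) (c - k)) (j = min (beta f s) (d - k)) * F j k)"
    if "k \<in> T_range E f t" for k
    unfolding slice_sum_def T_range_def beta_slice sets alpha_slice[OF st(1,3,2) that]
    by (simp add: F_def c_def d_def slice_rank_commute[of f t])
  show ?thesis
    using hexagon_sum_swap[of _ _ _ _ c d F, OF AB cd c1 c2 c3 d1 d2 d3 Fc Fd]
    by (simp add: L R T_range_def[symmetric] cong: sum.cong)
qed

section \<open>The recursion at an arbitrary element\<close>

lemma tutte_eq_slice_sum:
  assumes "rank_function E f" "t \<in> E"
  shows "tutte E (polymatroid E f) = slice_sum E f t"
  using assms
proof (induction "card E" arbitrary: E f t rule: less_induct)
  case less
  note f = less.prems(1) and t = less.prems(2)
  have fin: "finite E" using f by (rule rank_function_finite)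
  define m where "m = Max E"
  have E: "E \<noteq> {}" using t by auto
  then have m: "m \<in> E" using fin by (simp add: m_def)
  have top: "tutte E (polymatroid E f) = slice_sum E f m"
    using tutte_eq_slice_sum_Max[OF f E] by (simp add: m_def)
  show ?case
  proof (cases "t = m")
    case True
    with top show ?thesis by simp
  next
    case False
    \<comment> \<open>Both orders are covered: after slicing at \<open>m\<close> the expansion is at
      \<open>t\<close>, and after slicing at \<open>t\<close> it is at \<open>m\<close>.\<close>
    have IH: "tutte (E - {s}) (polymatroid (E - {s}) (slice_rank f s j)) =
        slice_sum (E - {s}) (slice_rank f s j) r"
      if "s \<in> E" "j \<in> T_range E f s" "r \<in> E" "r \<noteq> s" for s r j
      using that fin
      by (intro less.hyps rank_function_slice_rank[OF f])
        (auto intro: card_Diff1_less simp del: card_Diff_insert card_Diff_singleton)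
    have "slice_sum E f m = (\<Sum>k\<in>T_range E f m. act_weight (k = alpha E f m) (k = beta f m) *
        slice_sum (E - {m}) (slice_rank f m k) t)"
      unfolding slice_sum_def[of E f m] using IH[OF m _ t False] by simp
    also have "\<dots> = (\<Sum>j\<in>T_range E f t. act_weight (j = alpha E f t) (j = beta f t) *
        slice_sum (E - {t}) (slice_rank f t j) m)"
      using False by (intro double_slice_sum_swap[OF f m t]) auto
    also have "\<dots> = slice_sum E f t"
      unfolding slice_sum_def[of E f t] using IH[OF t _ m] False by simp
    finally show ?thesis using top by simp
  qed
qed

section \<open>The two cases of the recursion, and its well-definedness\<close>

lemma card_T_range_eq_1_iff:
  assumes "rank_function E f" "t \<in> E"
  shows "card (T_range E f t) = 1 \<longleftrightarrow> alpha E f t = beta f t"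
  using alpha_le_beta[OF assms] by (auto simp: T_range_def)

lemma tutte_single:
  assumes f: "rank_function E f" and t: "t \<in> E" and card: "card (T_range E f t) = 1"
  shows "tutte E (polymatroid E f) = (var_x + var_y - 1) * tutte (E - {t}) (deletion E f t)"
proof -
  have eq: "alpha E f t = beta f t" using card card_T_range_eq_1_iff[OF f t] by simp
  show ?thesis
    unfolding tutte_eq_slice_sum[OF f t] slice_sum_def deletion_eq_slice[OF f t]
    by (simp add: T_range_def eq act_weight_def)
qed

lemma tutte_multiple:
  assumes f: "rank_function E f" and t: "t \<in> E" and card: "card (T_range E f t) \<ge> 2"
  shows "tutte E (polymatroid E f) = var_x * tutte (E - {t}) (deletion E f t)
    + var_y * tutte (E - {t}) (contraction E f t)
    + (\<Sum>j\<in>T_range E f t - {alpha E f t, beta f t}.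
         tutte (E - {t}) (projected_slice E (polymatroid E f) t j))"
proof -
  let ?a = "alpha E f t" and ?b = "beta f t"
  define G where "G j = act_weight (j = ?a) (j = ?b) *
    tutte (E - {t}) (polymatroid (E - {t}) (slice_rank f t j))" for j
  have ne: "?a \<noteq> ?b" using card card_T_range_eq_1_iff[OF f t] by auto
  have fin: "finite (T_range E f t)" by (simp add: T_range_def)
  have mem: "?a \<in> T_range E f t" "?b \<in> T_range E f t - {?a}"
    using alpha_le_beta[OF f t] ne by (auto simp: T_range_def)
  have "tutte E (polymatroid E f) = sum G (T_range E f t)"
    unfolding tutte_eq_slice_sum[OF f t] slice_sum_def G_def ..
  also have "\<dots> = G ?a + (G ?b + sum G (T_range E f t - {?a} - {?b}))"
    using fin mem by (simp add: sum.remove[of _ ?a] sum.remove[of _ ?b])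
  also have "T_range E f t - {?a} - {?b} = T_range E f t - {?a, ?b}" by auto
  also have "G ?a = var_x * tutte (E - {t}) (deletion E f t)"
    using ne by (simp add: G_def act_weight_def deletion_eq_slice[OF f t])
  also have "G ?b = var_y * tutte (E - {t}) (contraction E f t)"
    using ne by (simp add: G_def act_weight_def contraction_eq_slice[OF f t])
  also have "sum G (T_range E f t - {?a, ?b}) = (\<Sum>j\<in>T_range E f t - {?a, ?b}.
      tutte (E - {t}) (projected_slice E (polymatroid E f) t j))"
    by (intro sum.cong refl) (auto simp: G_def act_weight_def projected_slice_eq[OF f t])
  finally show ?thesis by (simp add: add.assoc)
qed

lemma tutte_empty:
  assumes "rank_function {} f"
  shows "tutte {} (polymatroid {} f) = 1"
proof -
  have "polymatroid {} f = {\<lambda>_. undefined}"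
    using assms by (auto simp: polymatroid_def rank_function_empty)
  then show ?thesis by (simp add: tutte_eq_sum_basis_weight basis_weight_def)
qed

text \<open>Each rule, for whichever \<open>t\<close> it uses, turns Tutte polynomials of the
  smaller polymatroids into that of the given one. All derivations thus agree with
  \<open>tutte\<close>, and no two of them have to be compared directly.\<close>

lemma rec_value_unique: "rec_value E P p \<Longrightarrow> p = tutte E P"
proof (induction rule: rec_value.induct)
  case (empty f)
  then show ?case by (simp add: tutte_empty)
next
  case (single E f t p)
  then show ?case by (simp add: tutte_single)
next
  case (multiple E f t p q r)
  then show ?case by (simp add: tutte_multiple)
qed

lemma rec_value_tutte:
  assumes "rank_function E f"
  shows "rec_value E (polymatroid E f) (tutte E (polymatroid E f))"
  using assms
proof (induction "card E" arbitrary: E f rule: less_induct)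
  case less
  note f = less.prems
  have fin: "finite E" using f by (rule rank_function_finite)
  show ?case
  proof (cases "E = {}")
    case True
    with f show ?thesis using rec_value.empty[of f] by (simp add: tutte_empty)
  next
    case False
    then obtain t where t: "t \<in> E" by auto
    \<comment> \<open>Deletion and contraction are slices at the two ends of \<open>T_range\<close>,
      so this one statement serves all premises of the rules.\<close>
    have IH: "rec_value (E - {t}) (polymatroid (E - {t}) (slice_rank f t j))
        (tutte (E - {t}) (polymatroid (E - {t}) (slice_rank f t j)))"
      if "j \<in> T_range E f t" for j
      using that fin t
      by (intro less.hyps rank_function_slice_rank[OF f t])
        (auto intro: card_Diff1_less simp del: card_Diff_insert card_Diff_singleton)
    have mem: "alpha E f t \<in> T_range E f t" "beta f t \<in> T_range E f t"
      using alpha_le_beta[OF f t] by (auto simp: T_range_def)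
    have del: "rec_value (E - {t}) (deletion E f t) (tutte (E - {t}) (deletion E f t))"
      unfolding deletion_eq_slice[OF f t] using mem(1) by (rule IH)
    have con: "rec_value (E - {t}) (contraction E f t) (tutte (E - {t}) (contraction E f t))"
      unfolding contraction_eq_slice[OF f t] using mem(2) by (rule IH)
    have "card (T_range E f t) \<noteq> 0" using mem by (auto simp: T_range_def)
    then consider "card (T_range E f t) = 1" | "card (T_range E f t) \<ge> 2" by linarith
    then show ?thesis
    proof cases
      case 1
      show ?thesis
        unfolding tutte_single[OF f t 1] using f t 1 del by (rule rec_value.single)
    next
      case 2
      show ?thesis
        unfolding tutte_multiple[OF f t 2]
        using f t 2 del con
        by (rule rec_value.multiple) (auto simp: projected_slice_eq[OF f t] intro: IH)
    qed
  qed
qed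

lemma tutte_rec_eq_tutte:
  assumes "rank_function E f"
  shows "tutte_rec E (polymatroid E f) = tutte E (polymatroid E f)"
  unfolding tutte_rec_def
  using rec_value_tutte[OF assms] rec_value_unique by (rule the_equality)

text \<open>Slices, and likewise deletion and contraction below, are polymatroids of
  \<open>slice_rank\<close>, so the recursion has a unique value on them too and the identities for
  \<open>tutte\<close> carry over to \<open>tutte_rec\<close>.\<close>

lemma tutte_rec_slice:
  assumes "rank_function E f" "t \<in> E" "j \<in> T_range E f t"
  shows "tutte_rec (E - {t}) (projected_slice E (polymatroid E f) t j) =
    tutte (E - {t}) (projected_slice E (polymatroid E f) t j)"
  unfolding projected_slice_eq[OF assms]
  by (rule tutte_rec_eq_tutte) (rule rank_function_slice_rank[OF assms])

lemma tutte_rec_deletion: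
  assumes "rank_function E f" "t \<in> E"
  shows "tutte_rec (E - {t}) (deletion E f t) = tutte (E - {t}) (deletion E f t)"
  unfolding deletion_eq_slice[OF assms] using alpha_le_beta[OF assms]
  by (intro tutte_rec_eq_tutte rank_function_slice_rank[OF assms]) (simp add: T_range_def)

lemma tutte_rec_contraction:
  assumes "rank_function E f" "t \<in> E"
  shows "tutte_rec (E - {t}) (contraction E f t) = tutte (E - {t}) (contraction E f t)"
  unfolding contraction_eq_slice[OF assms] using alpha_le_beta[OF assms]
  by (intro tutte_rec_eq_tutte rank_function_slice_rank[OF assms]) (simp add: T_range_def)

theorem theorem1p12:
  fixes E :: "nat set" and f :: "nat set \<Rightarrow> int"
  assumes "rank_function E f"
  shows "(\<exists>!p. rec_value E (polymatroid E f) p)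
    \<and> (E = {} \<longrightarrow> tutte_rec E (polymatroid E f) = 1)
    \<and> (\<forall>t\<in>E.
         (card (T_range E f t) = 1 \<longrightarrow>
            tutte_rec E (polymatroid E f)
              = (var_x + var_y - 1) * tutte_rec (E - {t}) (deletion E f t))
       \<and> (card (T_range E f t) \<ge> 2 \<longrightarrow>
            tutte_rec E (polymatroid E f)
              = var_x * tutte_rec (E - {t}) (deletion E f t)
              + var_y * tutte_rec (E - {t}) (contraction E f t)
              + (\<Sum>j\<in>T_range E f t - {alpha E f t, beta f t}.
                   tutte_rec (E - {t}) (projected_slice E (polymatroid E f) t j))))
    \<and> tutte_rec E (polymatroid E f) = tutte E (polymatroid E f)"
proof (intro conjI impI ballI)
  show "\<exists>!p. rec_value E (polymatroid E f) p"
    using rec_value_tutte[OF assms] rec_value_unique by blast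
  show "tutte_rec E (polymatroid E f) = tutte E (polymatroid E f)"
    using assms by (rule tutte_rec_eq_tutte)
  show "tutte_rec E (polymatroid E f) = 1" if "E = {}"
    using assms that by (simp add: tutte_rec_eq_tutte tutte_empty)
next
  fix t assume t: "t \<in> E" and card: "card (T_range E f t) = 1"
  show "tutte_rec E (polymatroid E f)
      = (var_x + var_y - 1) * tutte_rec (E - {t}) (deletion E f t)"
    using tutte_single[OF assms t card]
    by (simp add: tutte_rec_eq_tutte[OF assms] tutte_rec_deletion[OF assms t])
next
  fix t assume t: "t \<in> E" and card: "card (T_range E f t) \<ge> 2"
  show "tutte_rec E (polymatroid E f)
      = var_x * tutte_rec (E - {t}) (deletion E f t)
      + var_y * tutte_rec (E - {t}) (contraction E f t)
      + (\<Sum>j\<in>T_range E f t - {alpha E f t, beta f t}.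
           tutte_rec (E - {t}) (projected_slice E (polymatroid E f) t j))"
    using tutte_multiple[OF assms t card]
    by (simp add: tutte_rec_eq_tutte[OF assms] tutte_rec_deletion[OF assms t]
        tutte_rec_contraction[OF assms t] tutte_rec_slice[OF assms t])
qed

end
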